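(* For any real number $\lambda\neq 0,2$ there exists a radiant Hessian manifold $(C,\nabla,g,\xi)$ with $\xi=\lambda\rho$, where $\rho$ is a radiant vector field on $C$.
   Context: A flat affine manifold $(C,\nabla)$ is a manifold with a flat torsion-free connection. A Hessian manifold $(C,\nabla,g)$ is a flat affine manifold with a Riemannian metric $g$ (positive definite) that is locally $\nabla d\varphi$ for a function $\varphi$. A selfsimilar Hessian manifold $(C,\nabla,g,\xi)$ is a Hessian manifold with a vector field $\xi$ such that $\mathcal{L}_\xi g=2g$ and the flow of $\xi$ preserves $\nabla$. A radiant vector field is a field $\rho$ with $\nabla\rho=\mathrm{Id}$. A radiant Hessian manifold is a selfsimilar Hessian manifold for which $\xi=\lambda\rho$ with $\rho$ a radiant vector field and $\lambda\ne0,2$ a constant. Manifolds are of positive dimension. *)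

theory Defs
  imports "HOL-Analysis.Analysis"
begin

section \<open>Smooth functions on open subsets of Euclidean space\<close>

definition partial_deriv :: "nat \<Rightarrow> ((nat \<Rightarrow> real) \<Rightarrow> real) \<Rightarrow> (nat \<Rightarrow> real) \<Rightarrow> real" where
  "partial_deriv i f x = deriv (\<lambda>t. f (x(i := t))) (x i)"

text \<open>A \<open>C\<^sup>\<infinity>\<close> function on an open \<open>W\<close>: all iterated partial derivatives
  (\<open>foldr partial_deriv is f\<close>, with \<open>is\<close> a list of directions) exist and are continuous on \<open>W\<close>.\<close>

definition smooth_euclidean :: "nat \<Rightarrow> (nat \<Rightarrow> real) set \<Rightarrow> ((nat \<Rightarrow> real) \<Rightarrow> real) \<Rightarrow> bool" where
  "smooth_euclidean n W f \<longleftrightarrow>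
     openin (Euclidean_space n) W \<and>
     (\<forall>is. set is \<subseteq> {..<n} \<longrightarrow>
        continuous_map (subtopology (Euclidean_space n) W) euclideanreal (foldr partial_deriv is f) \<and>
        (\<forall>x\<in>W. \<forall>i<n. (\<lambda>t. foldr partial_deriv is f (x(i := t))) field_differentiable (at (x i))))"

section \<open>Smooth manifolds\<close>

text \<open>A chart is a pair of its domain and its coordinate map. The atlas need not be maximal.\<close>

type_synonym 'a chart = "'a set \<times> ('a \<Rightarrow> nat \<Rightarrow> real)"

record 'a manifold =
  mdim :: nat
  mtop :: "'a topology"
  atlas :: "'a chart set"

abbreviation points :: "'a manifold \<Rightarrow> 'a set" where
  "points C \<equiv> topspace (mtop C)"

definition smooth_manifold :: "'a manifold \<Rightarrow> bool" where
  "smooth_manifold C \<longleftrightarrow>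
     0 < mdim C \<and> points C \<noteq> {} \<and>
     Hausdorff_space (mtop C) \<and> second_countable (mtop C) \<and>
     (\<Union>(U, \<phi>)\<in>atlas C. U) = points C \<and>
     (\<forall>(U, \<phi>)\<in>atlas C.
        openin (mtop C) U \<and> openin (Euclidean_space (mdim C)) (\<phi> ` U) \<and>
        homeomorphic_map (subtopology (mtop C) U)
          (subtopology (Euclidean_space (mdim C)) (\<phi> ` U)) \<phi>) \<and>
     (\<forall>(U, \<phi>)\<in>atlas C. \<forall>(V, \<psi>)\<in>atlas C. \<forall>k<mdim C.
        smooth_euclidean (mdim C) (\<phi> ` (U \<inter> V)) (\<lambda>x. \<psi> (inv_into U \<phi> x) k))"

definition smooth_on :: "'a manifold \<Rightarrow> 'a set \<Rightarrow> ('a \<Rightarrow> real) \<Rightarrow> bool" where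
  "smooth_on C U f \<longleftrightarrow>
     openin (mtop C) U \<and>
     (\<forall>(V, \<phi>)\<in>atlas C. smooth_euclidean (mdim C) (\<phi> ` (U \<inter> V)) (\<lambda>x. f (inv_into V \<phi> x)))"

definition smooth_near :: "'a manifold \<Rightarrow> 'a \<Rightarrow> ('a \<Rightarrow> real) \<Rightarrow> bool" where
  "smooth_near C p f \<longleftrightarrow> (\<exists>U. p \<in> U \<and> smooth_on C U f)"

section \<open>Tangent vectors and vector fields\<close>

text \<open>Tangent vectors at \<open>p\<close> are the derivations of the algebra of germs at \<open>p\<close> of smooth functions.
  They are represented as functionals on all real functions, with the convention that they take
  the value 0 on functions not smooth near \<open>p\<close>; so equality of tangent vectors is equality of
  functionals, and the zero vector is \<open>\<lambda>f. 0\<close>.\<close>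

type_synonym 'a tvec = "('a \<Rightarrow> real) \<Rightarrow> real"

definition tangent_space :: "'a manifold \<Rightarrow> 'a \<Rightarrow> 'a tvec set" where
  "tangent_space C p = {v.
     (\<forall>f h. smooth_near C p f \<and> smooth_near C p h \<longrightarrow>
        v (\<lambda>x. f x + h x) = v f + v h \<and>
        v (\<lambda>x. f x * h x) = f p * v h + h p * v f) \<and>
     (\<forall>c f. smooth_near C p f \<longrightarrow> v (\<lambda>x. c * f x) = c * v f) \<and>
     (\<forall>U f h. openin (mtop C) U \<and> p \<in> U \<and> smooth_on C U f \<and> (\<forall>x\<in>U. f x = h x) \<longrightarrow> v f = v h) \<and>
     (\<forall>f. \<not> smooth_near C p f \<longrightarrow> v f = 0)}"

text \<open>Smooth vector fields on an open set; the values outside \<open>U\<close> are irrelevant.\<close>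

type_synonym 'a vfield = "'a \<Rightarrow> 'a tvec"

definition vector_field :: "'a manifold \<Rightarrow> 'a set \<Rightarrow> 'a vfield \<Rightarrow> bool" where
  "vector_field C U X \<longleftrightarrow>
     openin (mtop C) U \<and>
     (\<forall>p\<in>U. X p \<in> tangent_space C p) \<and>
     (\<forall>V f. V \<subseteq> U \<and> smooth_on C V f \<longrightarrow> smooth_on C V (\<lambda>p. X p f))"

definition bracket :: "'a manifold \<Rightarrow> 'a vfield \<Rightarrow> 'a vfield \<Rightarrow> 'a vfield" where
  "bracket C X Y = (\<lambda>p f. if smooth_near C p f then X p (\<lambda>q. Y q f) - Y p (\<lambda>q. X q f) else 0)"

definition pushforward :: "'a manifold \<Rightarrow> ('a \<Rightarrow> 'a) \<Rightarrow> 'a \<Rightarrow> 'a tvec \<Rightarrow> 'a tvec" where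
  "pushforward C \<theta> p v = (\<lambda>f. if smooth_near C (\<theta> p) f then v (\<lambda>x. f (\<theta> x)) else 0)"

section \<open>Flat torsion-free connections\<close>

text \<open>\<open>D p v Y\<close> is the covariant derivative at \<open>p\<close>, in the direction of the tangent vector \<open>v\<close>, of a
  vector field \<open>Y\<close> defined near \<open>p\<close>. For vector fields \<open>X\<close>, \<open>Y\<close>, the field \<open>\<nabla>\<^sub>X Y\<close> is \<open>\<lambda>p. D p (X p) Y\<close>.\<close>

type_synonym 'a conn = "'a \<Rightarrow> 'a tvec \<Rightarrow> 'a vfield \<Rightarrow> 'a tvec"

definition connection :: "'a manifold \<Rightarrow> 'a conn \<Rightarrow> bool" where
  "connection C D \<longleftrightarrow>
     (\<forall>U Y p. vector_field C U Y \<and> p \<in> U \<longrightarrow>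
        (\<forall>v\<in>tangent_space C p.
           D p v Y \<in> tangent_space C p \<and>
           (\<forall>w\<in>tangent_space C p. D p (\<lambda>f. v f + w f) Y = (\<lambda>f. D p v Y f + D p w Y f)) \<and>
           (\<forall>c. D p (\<lambda>f. c * v f) Y = (\<lambda>f. c * D p v Y f)) \<and>
           (\<forall>Z. vector_field C U Z \<longrightarrow>
              D p v (\<lambda>q f. Y q f + Z q f) = (\<lambda>f. D p v Y f + D p v Z f)) \<and>
           (\<forall>a. smooth_on C U a \<longrightarrow>
              D p v (\<lambda>q f. a q * Y q f) = (\<lambda>f. v a * Y p f + a p * D p v Y f)) \<and>
           (\<forall>Z. (\<forall>q\<in>U. Z q = Y q) \<longrightarrow> D p v Z = D p v Y))) \<and>
     (\<forall>U X Y. vector_field C U X \<and> vector_field C U Y \<longrightarrow> vector_field C U (\<lambda>p. D p (X p) Y))"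

definition torsion_free :: "'a manifold \<Rightarrow> 'a conn \<Rightarrow> bool" where
  "torsion_free C D \<longleftrightarrow>
     (\<forall>U X Y. vector_field C U X \<and> vector_field C U Y \<longrightarrow>
        (\<forall>p\<in>U. \<forall>f. D p (X p) Y f - D p (Y p) X f - bracket C X Y p f = 0))"

definition flat :: "'a manifold \<Rightarrow> 'a conn \<Rightarrow> bool" where
  "flat C D \<longleftrightarrow>
     (\<forall>U X Y Z. vector_field C U X \<and> vector_field C U Y \<and> vector_field C U Z \<longrightarrow>
        (\<forall>p\<in>U. \<forall>f. D p (X p) (\<lambda>q. D q (Y q) Z) f - D p (Y p) (\<lambda>q. D q (X q) Z) f
                      - D p (bracket C X Y p) Z f = 0))"

definition flat_affine_manifold :: "'a manifold \<Rightarrow> 'a conn \<Rightarrow> bool" where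
  "flat_affine_manifold C D \<longleftrightarrow>
     smooth_manifold C \<and> connection C D \<and> flat C D \<and> torsion_free C D"

section \<open>Hessian manifolds\<close>

type_synonym 'a metric = "'a \<Rightarrow> 'a tvec \<Rightarrow> 'a tvec \<Rightarrow> real"

definition riemannian_metric :: "'a manifold \<Rightarrow> 'a metric \<Rightarrow> bool" where
  "riemannian_metric C g \<longleftrightarrow>
     (\<forall>p\<in>points C. \<forall>u\<in>tangent_space C p. \<forall>v\<in>tangent_space C p.
        g p u v = g p v u \<and>
        (\<forall>w\<in>tangent_space C p. g p (\<lambda>f. u f + w f) v = g p u v + g p w v) \<and>
        (\<forall>c. g p (\<lambda>f. c * u f) v = c * g p u v)) \<and>
     (\<forall>p\<in>points C. \<forall>v\<in>tangent_space C p. v \<noteq> (\<lambda>f. 0) \<longrightarrow> 0 < g p v v) \<and>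
     (\<forall>U X Y. vector_field C U X \<and> vector_field C U Y \<longrightarrow> smooth_on C U (\<lambda>p. g p (X p) (Y p)))"

text \<open>\<open>(\<nabla>d\<phi>)(X, Y) = X (Y \<phi>) - (\<nabla>\<^sub>X Y) \<phi>\<close>\<close>

definition hessian :: "'a conn \<Rightarrow> ('a \<Rightarrow> real) \<Rightarrow> 'a vfield \<Rightarrow> 'a vfield \<Rightarrow> 'a \<Rightarrow> real" where
  "hessian D \<phi> X Y p = X p (\<lambda>q. Y q \<phi>) - D p (X p) Y \<phi>"

definition hessian_manifold :: "'a manifold \<Rightarrow> 'a conn \<Rightarrow> 'a metric \<Rightarrow> bool" where
  "hessian_manifold C D g \<longleftrightarrow>
     flat_affine_manifold C D \<and> riemannian_metric C g \<and>
     (\<forall>p\<in>points C. \<exists>U \<phi>. p \<in> U \<and> smooth_on C U \<phi> \<and>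
        (\<forall>V X Y. V \<subseteq> U \<and> vector_field C V X \<and> vector_field C V Y \<longrightarrow>
           (\<forall>q\<in>V. g q (X q) (Y q) = hessian D \<phi> X Y q)))"

section \<open>Selfsimilar and radiant Hessian manifolds\<close>

definition lie_deriv_metric ::
    "'a manifold \<Rightarrow> 'a vfield \<Rightarrow> 'a metric \<Rightarrow> 'a vfield \<Rightarrow> 'a vfield \<Rightarrow> 'a \<Rightarrow> real" where
  "lie_deriv_metric C \<xi> g X Y p =
     \<xi> p (\<lambda>q. g q (X q) (Y q)) - g p (bracket C \<xi> X p) (Y p) - g p (X p) (bracket C \<xi> Y p)"

text \<open>A vector field need not be complete, so its flow is described by its restrictions to open
  sets \<open>U\<close> of initial points and open time intervals \<open>I\<close> containing 0 on which it is defined.\<close>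

definition local_flow ::
    "'a manifold \<Rightarrow> 'a vfield \<Rightarrow> real set \<Rightarrow> 'a set \<Rightarrow> (real \<Rightarrow> 'a \<Rightarrow> 'a) \<Rightarrow> bool" where
  "local_flow C \<xi> I U \<theta> \<longleftrightarrow>
     open I \<and> is_interval I \<and> 0 \<in> I \<and> openin (mtop C) U \<and>
     (\<forall>p\<in>U. \<theta> 0 p = p \<and>
        continuous_map (top_of_set I) (mtop C) (\<lambda>t. \<theta> t p) \<and>
        (\<forall>t\<in>I. \<forall>f. smooth_near C (\<theta> t p) f \<longrightarrow>
           ((\<lambda>s. f (\<theta> s p)) has_real_derivative \<xi> (\<theta> t p) f) (at t)))"

text \<open>\<open>\<theta>\<^sub>t\<close> is a diffeomorphism of \<open>U\<close> onto an open set, and \<open>(\<theta>\<^sub>t)\<^sub>* (\<nabla>\<^sub>v Y) = \<nabla>\<^bsub>(\<theta>\<^sub>t)\<^sub>* v\<^esub> (\<theta>\<^sub>t)\<^sub>* Y\<close>.\<close>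

definition flow_preserves :: "'a manifold \<Rightarrow> 'a conn \<Rightarrow> 'a vfield \<Rightarrow> bool" where
  "flow_preserves C D \<xi> \<longleftrightarrow>
     (\<forall>I U \<theta>. local_flow C \<xi> I U \<theta> \<longrightarrow>
        (\<forall>t\<in>I. \<forall>Y. vector_field C U Y \<longrightarrow>
           (\<forall>p\<in>U. \<forall>v\<in>tangent_space C p.
              pushforward C (\<theta> t) p (D p v Y) =
              D (\<theta> t p) (pushforward C (\<theta> t) p v)
                (\<lambda>q. let r = inv_into U (\<theta> t) q in pushforward C (\<theta> t) r (Y r)))))"

definition selfsimilar_hessian_manifold ::
    "'a manifold \<Rightarrow> 'a conn \<Rightarrow> 'a metric \<Rightarrow> 'a vfield \<Rightarrow> bool" where
  "selfsimilar_hessian_manifold C D g \<xi> \<longleftrightarrow>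
     hessian_manifold C D g \<and> vector_field C (points C) \<xi> \<and>
     (\<forall>U X Y. vector_field C U X \<and> vector_field C U Y \<longrightarrow>
        (\<forall>p\<in>U. lie_deriv_metric C \<xi> g X Y p = 2 * g p (X p) (Y p))) \<and>
     flow_preserves C D \<xi>"

definition radiant_vector_field :: "'a manifold \<Rightarrow> 'a conn \<Rightarrow> 'a vfield \<Rightarrow> bool" where
  "radiant_vector_field C D \<rho> \<longleftrightarrow>
     vector_field C (points C) \<rho> \<and> (\<forall>p\<in>points C. \<forall>v\<in>tangent_space C p. D p v \<rho> = v)"

definition radiant_hessian_manifold ::
    "'a manifold \<Rightarrow> 'a conn \<Rightarrow> 'a metric \<Rightarrow> 'a vfield \<Rightarrow> bool" where
  "radiant_hessian_manifold C D g \<xi> \<longleftrightarrow>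
     selfsimilar_hessian_manifold C D g \<xi> \<and>
     (\<exists>\<rho> l. radiant_vector_field C D \<rho> \<and> l \<noteq> 0 \<and> l \<noteq> 2 \<and>
        (\<forall>p\<in>points C. \<xi> p = (\<lambda>f. l * \<rho> p f)))"

end

theory Submission
  imports Defs
begin

text \<open>
  The manifold is the half-line \<open>x > 0\<close> with the connection for which \<open>d/dx\<close> is parallel. The Euler
  field \<open>\<rho> = x d/dx\<close> is radiant, and the flow of \<open>l \<rho>\<close> consists of the dilations
  \<open>x \<mapsto> exp (l t) x\<close>, which are affine and so preserve the connection (lemmas
  \<open>radiant_euler_field\<close>, \<open>local_flow_euler\<close> and \<open>flow_preserves_euler\<close>). The metric
  \<open>x powr a dx\<^sup>2\<close> is homogeneous: its Lie derivative along \<open>l \<rho>\<close> is \<open>l (a + 2)\<close> times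
  itself (\<open>lie_deriv_power_metric\<close>). The choice \<open>a = 2 / l - 2\<close> therefore makes it selfsimilar. It
  is the Hessian of \<open>x powr (a + 2) / ((a + 2) (a + 1))\<close> (\<open>hessian_manifold_half_line\<close>), where
  \<open>a + 2 = 2 / l\<close> is not zero and \<open>a + 1\<close> vanishes only for \<open>l = 2\<close>.

  Tangent vectors are derivations of germs, so the computation in coordinates has to be justified by
  showing that every derivation at a point is a multiple of \<open>d/dx\<close> (\<open>tangent_space_half_line\<close>).
  This rests on Hadamard's lemma, which factors a smooth function vanishing at \<open>p\<close> as \<open>x - p\<close> times
  a smooth function (\<open>hadamard\<close>). The points of the half-line are sequences supported at the index 0;
  the map \<open>line\<close> carries the real half-line onto them, and smoothness on the manifold is reduced along
  it to iterated differentiability of functions of one real variable (\<open>smooth_on_half_line\<close>).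
\<close>

section \<open>Smooth functions of one real variable\<close>

text \<open>The derivative is existentially quantified, not given by \<^const>\<open>deriv\<close>, so that closure
  properties are proved by exhibiting a formula for it that is valid on \<open>T\<close>.\<close>

primrec times_differentiable :: "nat \<Rightarrow> real set \<Rightarrow> (real \<Rightarrow> real) \<Rightarrow> bool" where
  "times_differentiable 0 T F \<longleftrightarrow> True"
| "times_differentiable (Suc k) T F \<longleftrightarrow>
     (\<exists>F'. (\<forall>t\<in>T. (F has_real_derivative F' t) (at t)) \<and> times_differentiable k T F')"

lemma times_differentiable_SucI:
  assumes "\<And>t. t \<in> T \<Longrightarrow> (F has_real_derivative F' t) (at t)" "times_differentiable k T F'"
  shows "times_differentiable (Suc k) T F"
  using assms by auto

declare times_differentiable.simps(2) [simp del]

lemma times_differentiable_SucE: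
  assumes "times_differentiable (Suc k) T F"
  obtains F' where "\<And>t. t \<in> T \<Longrightarrow> (F has_real_derivative F' t) (at t)" "times_differentiable k T F'"
  using assms by (auto simp: times_differentiable.simps(2))

definition smooth_real :: "real set \<Rightarrow> (real \<Rightarrow> real) \<Rightarrow> bool" where
  "smooth_real T F \<longleftrightarrow> open T \<and> (\<forall>k. times_differentiable k T F)"

lemma times_differentiable_cong:
  assumes "times_differentiable k T F" "open T" "\<And>t. t \<in> T \<Longrightarrow> F t = G t"
  shows "times_differentiable k T G"
proof (cases k)
  case (Suc j)
  then obtain F' where F': "\<And>t. t \<in> T \<Longrightarrow> (F has_real_derivative F' t) (at t)"
    "times_differentiable j T F'"
    using assms(1) times_differentiable_SucE by blast
  have "(G has_real_derivative F' t) (at t)" if "t \<in> T" for t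
    using has_field_derivative_transform_within_open[OF F'(1)[OF that] assms(2) that assms(3)] .
  then show ?thesis unfolding Suc using F'(2) by (rule times_differentiable_SucI)
qed simp

lemma times_differentiable_subset:
  "times_differentiable k T F \<Longrightarrow> S \<subseteq> T \<Longrightarrow> times_differentiable k S F"
proof (induction k arbitrary: F)
  case (Suc k)
  from Suc.prems(1) obtain F' where
    F': "\<And>t. t \<in> T \<Longrightarrow> (F has_real_derivative F' t) (at t)" "times_differentiable k T F'"
    by (rule times_differentiable_SucE) blast
  show ?case
    by (rule times_differentiable_SucI[OF _ Suc.IH[OF F'(2) Suc.prems(2)]])
       (use F'(1) Suc.prems(2) in blast)
qed simp

lemma times_differentiable_Suc_imp: "times_differentiable (Suc k) T F \<Longrightarrow> times_differentiable k T F"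
proof (induction k arbitrary: F)
  case (Suc k)
  from Suc.prems obtain F' where
    F': "\<And>t. t \<in> T \<Longrightarrow> (F has_real_derivative F' t) (at t)" "times_differentiable (Suc k) T F'"
    by (rule times_differentiable_SucE) blast
  show ?case
    by (rule times_differentiable_SucI[OF F'(1) Suc.IH[OF F'(2)]])
qed simp

lemma times_differentiable_Suc_iff:
  assumes "open T"
  shows "times_differentiable (Suc k) T F \<longleftrightarrow>
    (\<forall>t\<in>T. F field_differentiable (at t)) \<and> times_differentiable k T (deriv F)"
proof
  assume "times_differentiable (Suc k) T F"
  then obtain F' where F': "\<And>t. t \<in> T \<Longrightarrow> (F has_real_derivative F' t) (at t)"
    "times_differentiable k T F'" using times_differentiable_SucE by blast
  moreover have "F' t = deriv F t" if "t \<in> T" for t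
    using F'(1)[OF that] by (simp add: DERIV_imp_deriv)
  ultimately show "(\<forall>t\<in>T. F field_differentiable (at t)) \<and> times_differentiable k T (deriv F)"
    using times_differentiable_cong[OF F'(2) assms] by (auto simp: field_differentiable_def)
next
  assume "(\<forall>t\<in>T. F field_differentiable (at t)) \<and> times_differentiable k T (deriv F)"
  then show "times_differentiable (Suc k) T F"
    by (intro times_differentiable_SucI[of T F "deriv F"]) (auto simp: field_differentiable_derivI)
qed

lemma times_differentiable_const: "times_differentiable k T (\<lambda>t. c)"
proof (induction k arbitrary: c)
  case (Suc k)
  show ?case by (rule times_differentiable_SucI[OF _ Suc[of 0]]) simp
qed simp

lemma times_differentiable_id: "times_differentiable k T (\<lambda>t. t)"
proof (cases k)
  case (Suc j)
  show ?thesis unfolding Suc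
    by (rule times_differentiable_SucI[OF _ times_differentiable_const[of j T 1]]) simp
qed simp

lemma times_differentiable_add:
  "times_differentiable k T F \<Longrightarrow> times_differentiable k T G \<Longrightarrow>
    times_differentiable k T (\<lambda>t. F t + G t)"
proof (induction k arbitrary: F G)
  case (Suc k)
  then obtain F' G' where
    *: "\<And>t. t \<in> T \<Longrightarrow> (F has_real_derivative F' t) (at t)" "times_differentiable k T F'"
       "\<And>t. t \<in> T \<Longrightarrow> (G has_real_derivative G' t) (at t)" "times_differentiable k T G'"
    by (metis times_differentiable_SucE)
  show ?case
    by (rule times_differentiable_SucI[OF _ Suc.IH[OF *(2,4)]]) (use * in \<open>auto intro: DERIV_add\<close>)
qed simp

lemma times_differentiable_mult:
  "times_differentiable k T F \<Longrightarrow> times_differentiable k T G \<Longrightarrow>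
    times_differentiable k T (\<lambda>t. F t * G t)"
proof (induction k arbitrary: F G)
  case (Suc k)
  then obtain F' G' where
    *: "\<And>t. t \<in> T \<Longrightarrow> (F has_real_derivative F' t) (at t)" "times_differentiable k T F'"
       "\<And>t. t \<in> T \<Longrightarrow> (G has_real_derivative G' t) (at t)" "times_differentiable k T G'"
    by (metis times_differentiable_SucE)
  have "((\<lambda>t. F t * G t) has_real_derivative F' t * G t + G' t * F t) (at t)" if "t \<in> T" for t
    using *(1,3)[OF that] by (rule DERIV_mult)
  moreover have "times_differentiable k T (\<lambda>t. F' t * G t + G' t * F t)"
    by (intro times_differentiable_add Suc.IH * Suc.prems[THEN times_differentiable_Suc_imp])
  ultimately show ?case by (rule times_differentiable_SucI)
qed simp

lemma times_differentiable_powr: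
  "T \<subseteq> {0<..} \<Longrightarrow> times_differentiable k T (\<lambda>t. t powr a)"
proof (induction k arbitrary: a)
  case (Suc k)
  have "((\<lambda>t. t powr a) has_real_derivative a * t powr (a - 1)) (at t)" if "t \<in> T" for t
    using Suc.prems that by (intro has_real_derivative_powr) auto
  moreover have "times_differentiable k T (\<lambda>t. a * t powr (a - 1))"
    using Suc by (intro times_differentiable_mult times_differentiable_const) auto
  ultimately show ?case by (rule times_differentiable_SucI)
qed simp

lemma times_differentiable_scaled:
  "times_differentiable k T F \<Longrightarrow> times_differentiable k {t. c * t \<in> T} (\<lambda>t. F (c * t))"
proof (induction k arbitrary: F)
  case (Suc k)
  then obtain F' where
    *: "\<And>t. t\<in>T \<Longrightarrow> (F has_real_derivative F' t) (at t)" "times_differentiable k T F'"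
    by (metis times_differentiable_SucE)
  have "((\<lambda>t. F (c * t)) has_real_derivative F' (c * t) * c) (at t)" if "c * t \<in> T" for t
    by (rule DERIV_chain2[of F _ "\<lambda>t. c * t"]) (use *(1)[OF that] in \<open>auto intro!: derivative_eq_intros\<close>)
  moreover have "times_differentiable k {t. c * t \<in> T} (\<lambda>t. F' (c * t) * c)"
    by (intro times_differentiable_mult times_differentiable_const Suc.IH *)
  ultimately show ?case by (intro times_differentiable_SucI) auto
qed simp

lemma smooth_real_deriv:
  "smooth_real T F \<Longrightarrow> smooth_real T (deriv F)"
  unfolding smooth_real_def using times_differentiable_Suc_iff by blast

lemma smooth_real_has_derivative:
  "smooth_real T F \<Longrightarrow> t \<in> T \<Longrightarrow> (F has_real_derivative deriv F t) (at t)"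
  unfolding smooth_real_def using times_differentiable_Suc_iff[of T 0 F]
  by (auto simp: field_differentiable_derivI)

lemma smooth_real_continuous_on: "smooth_real T F \<Longrightarrow> continuous_on T F"
  by (meson DERIV_continuous_on DERIV_subset smooth_real_has_derivative subset_UNIV)

lemma smooth_real_iff_iterated_deriv:
  "smooth_real T F \<longleftrightarrow> open T \<and> (\<forall>k. \<forall>t\<in>T. (deriv ^^ k) F field_differentiable (at t))"
proof
  assume S: "smooth_real T F"
  have "smooth_real T ((deriv ^^ k) F)" for k
    by (induction k) (use S smooth_real_deriv in auto)
  then show "open T \<and> (\<forall>k. \<forall>t\<in>T. (deriv ^^ k) F field_differentiable (at t))"
    using smooth_real_has_derivative S smooth_real_def unfolding field_differentiable_def by blast
next
  assume *: "open T \<and> (\<forall>k. \<forall>t\<in>T. (deriv ^^ k) F field_differentiable (at t))"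
  have "times_differentiable k T ((deriv ^^ j) F)" for k j
  proof (induction k arbitrary: j)
    case (Suc k)
    from Suc[of "Suc j"] show ?case using * by (subst times_differentiable_Suc_iff) auto
  qed simp
  from this[of _ 0] show "smooth_real T F" using * by (simp add: smooth_real_def)
qed

lemma mem_convex_between:
  fixes T :: "real set"
  assumes "convex T" "p \<in> T" "t \<in> T" "s \<in> {0..1}"
  shows "p + s * (t - p) \<in> T"
proof -
  have "(1 - s) *\<^sub>R p + s *\<^sub>R t \<in> T"
    using convexD_alt[OF assms(1-3)] assms(4) by simp
  then show ?thesis by (simp add: algebra_simps)
qed

text \<open>The weights \<open>s ^ n\<close> make the induction close: differentiating under the integral sign
  replaces \<open>F\<close> by its derivative and raises the weight by one.\<close>

lemma times_differentiable_mean: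
  fixes F :: "real \<Rightarrow> real"
  assumes "smooth_real T F" "convex T" "p \<in> T"
  shows "times_differentiable k T (\<lambda>t. integral {0..1} (\<lambda>s. s ^ n * F (p + s * (t - p))))"
  using assms(1)
proof (induction k arbitrary: F n)
  case (Suc k)
  have inT: "p + s * (t - p) \<in> T" if "t \<in> T" "s \<in> {0..1}" for s t
    using mem_convex_between[OF assms(2,3) that] .
  note F = Suc.prems
  have cont: "continuous_on (T \<times> {0..1}) (\<lambda>(t, s). s ^ n * G (p + s * (t - p)))"
    if "smooth_real T G" for G n
    unfolding split_beta
    by (intro continuous_intros continuous_on_compose2[OF smooth_real_continuous_on[OF that]])
       (use inT in auto)
  have d: "((\<lambda>t. integral (cbox 0 1) (\<lambda>s. s ^ n * F (p + s * (t - p)))) has_real_derivative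
      integral (cbox 0 1) (\<lambda>s. s ^ Suc n * deriv F (p + s * (t - p)))) (at t within T)" if "t \<in> T" for t
  proof (rule leibniz_rule_field_derivative)
    fix t s :: real assume ts: "t \<in> T" "s \<in> cbox 0 1"
    then have "(F has_real_derivative deriv F (p + s * (t - p))) (at (p + s * (t - p)))"
      using smooth_real_has_derivative[OF F] inT by simp
    then have "((\<lambda>t. F (p + s * (t - p))) has_real_derivative deriv F (p + s * (t - p)) * s) (at t)"
      by (rule DERIV_chain2) (auto intro!: derivative_eq_intros)
    then have "((\<lambda>t. s ^ n * F (p + s * (t - p))) has_real_derivative
       s ^ n * (deriv F (p + s * (t - p)) * s)) (at t)" by (rule DERIV_cmult)
    then show "((\<lambda>t. s ^ n * F (p + s * (t - p))) has_real_derivative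
       s ^ Suc n * deriv F (p + s * (t - p))) (at t within T)"
      by (simp add: algebra_simps has_field_derivative_at_within)
  next
    fix t :: real assume t: "t \<in> T"
    have "continuous_on (cbox 0 1) (\<lambda>s. s ^ n * F (p + s * (t - p)))"
      by (intro continuous_intros continuous_on_compose2[OF smooth_real_continuous_on[OF F]])
         (use inT[OF t] in auto)
    then show "(\<lambda>s. s ^ n * F (p + s * (t - p))) integrable_on cbox 0 1"
      by (rule integrable_continuous)
  next
    show "continuous_on (T \<times> cbox 0 1) (\<lambda>(t, s). s ^ Suc n * deriv F (p + s * (t - p)))"
      using cont[OF smooth_real_deriv[OF F], of "Suc n"] by (simp only: box_real)
  qed (fact that, fact assms(2))
  have d': "((\<lambda>t. integral {0..1} (\<lambda>s. s ^ n * F (p + s * (t - p)))) has_real_derivative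
      integral {0..1} (\<lambda>s. s ^ Suc n * deriv F (p + s * (t - p)))) (at t)" if t: "t \<in> T" for t
  proof -
    have "open T" using F unfolding smooth_real_def by blast
    with t have "at t within T = at t" by (rule at_within_open)
    then show "((\<lambda>t. integral {0..1} (\<lambda>s. s ^ n * F (p + s * (t - p)))) has_real_derivative
      integral {0..1} (\<lambda>s. s ^ Suc n * deriv F (p + s * (t - p)))) (at t)"
      using d[OF t] by (simp only: box_real)
  qed
  show ?case
    by (rule times_differentiable_SucI[OF d' Suc.IH[OF smooth_real_deriv[OF F], of "Suc n"]])
qed simp

text \<open>Hadamard's lemma: integrating the derivative of \<open>F\<close> along the segment from \<open>p\<close> to \<open>t\<close> gives
  the increment \<open>F t - F p\<close> as \<open>t - p\<close> times the mean of the derivative over the segment, and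
  that mean is smooth in \<open>t\<close>.\<close>

lemma hadamard:
  assumes F: "smooth_real T F" and "convex T" "p \<in> T"
  obtains G where "smooth_real T G" "\<And>t. t \<in> T \<Longrightarrow> F t = F p + (t - p) * G t" "G p = deriv F p"
proof
  define G where "G t = integral {0..1} (\<lambda>s. s ^ 0 * deriv F (p + s * (t - p)))" for t
  show "smooth_real T G"
    unfolding smooth_real_def G_def
    using times_differentiable_mean[OF smooth_real_deriv[OF F] assms(2,3)] F smooth_real_def by blast
  show "G p = deriv F p" by (simp add: G_def)
  fix t assume t: "t \<in> T"
  have inT: "p + s * (t - p) \<in> T" if "s \<in> {0..1}" for s
    using mem_convex_between[OF assms(2,3) t that] .
  have "((\<lambda>s. (t - p) * deriv F (p + s * (t - p))) has_integral F (p + 1 * (t - p)) - F (p + 0 * (t - p))) {0..1}"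
  proof (rule fundamental_theorem_of_calculus)
    fix s :: real assume s: "s \<in> {0..1}"
    have "((\<lambda>s. F (p + s * (t - p))) has_real_derivative deriv F (p + s * (t - p)) * (t - p)) (at s)"
      by (rule DERIV_chain2[where f=F and g="\<lambda>s. p + s * (t - p)", OF smooth_real_has_derivative[OF F inT[OF s]]])
         (auto intro!: derivative_eq_intros)
    then show "((\<lambda>s. F (p + s * (t - p))) has_vector_derivative (t - p) * deriv F (p + s * (t - p))) (at s within {0..1})"
      by (simp add: has_real_derivative_iff_has_vector_derivative mult.commute has_vector_derivative_at_within)
  qed simp
  then have "integral {0..1} (\<lambda>s. (t - p) * deriv F (p + s * (t - p))) = F t - F p"
    by (subst integral_unique) simp_all
  then show "F t = F p + (t - p) * G t" by (simp add: G_def)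
qed

section \<open>The half-line as a one-dimensional manifold\<close>

definition line :: "real \<Rightarrow> nat \<Rightarrow> real" where
  "line t = (\<lambda>i. if i = 0 then t else 0)"

lemma line_0 [simp]: "line t 0 = t"
  by (simp add: line_def)

lemma line_upd [simp]: "(line t)(0 := s) = line s"
  by (auto simp: line_def)

lemma topspace_Euclidean_1: "x \<in> topspace (Euclidean_space 1) \<longleftrightarrow> line (x 0) = x"
  by (auto simp: topspace_Euclidean_space line_def fun_eq_iff Suc_le_eq split: if_splits)

lemma openin_Euclidean_1:
  "openin (Euclidean_space 1) W \<longleftrightarrow> (\<forall>x\<in>W. line (x 0) = x) \<and> open {t. line t \<in> W}"
proof -
  have L: "continuous_map euclideanreal (Euclidean_space 1) line"
    unfolding line_def
    using continuous_map_componentwise_Euclidean_space[of euclideanreal 1 "\<lambda>t i. t"]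
    by (simp add: Suc_le_eq)
  have P: "continuous_map (Euclidean_space 1) euclideanreal (\<lambda>x. x 0)"
    unfolding Euclidean_space_def
    by (rule continuous_map_from_subtopology) (metis UNIV_I continuous_map_product_coordinates)
  show ?thesis
  proof
    assume W: "openin (Euclidean_space 1) W"
    have "\<forall>x\<in>W. line (x 0) = x"
      using openin_subset[OF W] topspace_Euclidean_1 by blast
    moreover have "open {t. line t \<in> W}"
      using openin_continuous_map_preimage[OF L W] by simp
    ultimately show "(\<forall>x\<in>W. line (x 0) = x) \<and> open {t. line t \<in> W}" by blast
  next
    assume *: "(\<forall>x\<in>W. line (x 0) = x) \<and> open {t. line t \<in> W}"
    then have "openin euclideanreal {t. line t \<in> W}" by simp
    from openin_continuous_map_preimage[OF P this]
    have "openin (Euclidean_space 1) {x \<in> topspace (Euclidean_space 1). x 0 \<in> {t. line t \<in> W}}" .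
    moreover have "{x \<in> topspace (Euclidean_space 1). x 0 \<in> {t. line t \<in> W}} = W"
      using * topspace_Euclidean_1 by auto
    ultimately show "openin (Euclidean_space 1) W" by simp
  qed
qed

lemma foldr_partial_deriv_line:
  "foldr partial_deriv (replicate k 0) f (line t) = (deriv ^^ k) (\<lambda>t. f (line t)) t"
  by (induction k arbitrary: t) (auto simp: partial_deriv_def)

text \<open>In dimension one the only list of directions of a given length is constant, so smoothness on an
  open set of the Euclidean line is iterated differentiability of one function of a real variable;
  the continuity demanded of each iterated derivative follows from its differentiability.\<close>

lemma smooth_euclidean_1:
  "smooth_euclidean 1 W f \<longleftrightarrow>
     (\<forall>x\<in>W. line (x 0) = x) \<and> smooth_real {t. line t \<in> W} (\<lambda>t. f (line t))"
proof -
  let ?F = "\<lambda>t. f (line t)"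
  let ?T = "{t. line t \<in> W}"
  have dirs: "set is \<subseteq> {..<1} \<longleftrightarrow> (\<exists>k. is = replicate k 0)" for "is" :: "nat list"
    by (metis One_nat_def empty_iff lessThan_0 lessThan_Suc insert_iff order.refl
         replicate_length_same set_replicate_conv_if subset_singletonD subset_iff)
  show ?thesis
  proof
    assume S: "smooth_euclidean 1 W f"
    then have W: "(\<forall>x\<in>W. line (x 0) = x)" "open ?T"
      by (auto simp: smooth_euclidean_def openin_Euclidean_1[unfolded One_nat_def])
    have "(deriv ^^ k) ?F field_differentiable (at t)" if "t \<in> ?T" for k t
    proof -
      have "(\<lambda>s. foldr partial_deriv (replicate k 0) f ((line t)(0 := s))) field_differentiable (at (line t 0))"
        using S dirs that unfolding smooth_euclidean_def by blast
      then show ?thesis by (simp only: foldr_partial_deriv_line line_upd line_0)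
    qed
    then show "(\<forall>x\<in>W. line (x 0) = x) \<and> smooth_real ?T ?F"
      using W by (auto simp: smooth_real_iff_iterated_deriv)
  next
    assume *: "(\<forall>x\<in>W. line (x 0) = x) \<and> smooth_real ?T ?F"
    have W: "openin (Euclidean_space 1) W"
      using * openin_Euclidean_1 smooth_real_def by blast
    have S: "smooth_real ?T ((deriv ^^ k) ?F)" for k
      by (induction k) (use * smooth_real_deriv in auto)
    have eq: "foldr partial_deriv (replicate k 0) f x = (deriv ^^ k) ?F (x 0)" if "x \<in> W" for k x
      using foldr_partial_deriv_line[of k f "x 0"] * that by simp
    have P: "continuous_map (subtopology (Euclidean_space 1) W) (top_of_set ?T) (\<lambda>x. x 0)"
      unfolding continuous_map_in_subtopology
    proof
      show "continuous_map (subtopology (Euclidean_space 1) W) euclidean (\<lambda>x. x 0)"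
        unfolding Euclidean_space_def
        by (intro continuous_map_from_subtopology) (metis UNIV_I continuous_map_product_coordinates)
    qed (use * in auto)
    have "continuous_map (subtopology (Euclidean_space 1) W) euclideanreal
        (foldr partial_deriv (replicate k 0) f)" for k
    proof -
      have "continuous_map (top_of_set ?T) euclideanreal ((deriv ^^ k) ?F)"
        using smooth_real_continuous_on[OF S] by simp
      from continuous_map_compose[OF P this] show ?thesis
        by (rule continuous_map_eq) (use eq in \<open>auto simp: eq\<close>)
    qed
    moreover have "(\<lambda>t. foldr partial_deriv (replicate k 0) f (x(0 := t))) field_differentiable (at (x 0))"
      if "x \<in> W" for k x
    proof -
      have "x(0 := t) = line t" for t using * that line_upd by metis
      moreover have "x 0 \<in> ?T" using * that by simp
      ultimately show ?thesis
        using smooth_real_has_derivative[OF S] unfolding field_differentiable_def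
        by (auto simp: foldr_partial_deriv_line simp del: foldr_replicate)
    qed
    ultimately show "smooth_euclidean 1 W f"
      unfolding smooth_euclidean_def dirs using W by auto
  qed
qed

definition half_line :: "(nat \<Rightarrow> real) manifold" where
  "half_line =
     \<lparr>mdim = 1, mtop = subtopology (Euclidean_space 1) (line ` {0<..}), atlas = {(line ` {0<..}, \<lambda>x. x)}\<rparr>"

lemma points_half_line: "points half_line = line ` {0<..}"
  by (auto simp: half_line_def topspace_Euclidean_1[simplified])

lemma line_mem [simp]: "line t \<in> line ` T \<longleftrightarrow> t \<in> T"
  by (metis image_iff line_0)

lemma openin_Euclidean_half_line: "openin (Euclidean_space 1) (line ` {0<..})"
  unfolding openin_Euclidean_1 by (auto simp: greaterThan_def[symmetric])

lemma openin_half_line: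
  "openin (mtop half_line) U \<longleftrightarrow> U \<subseteq> points half_line \<and> open {t. line t \<in> U}"
  using openin_Euclidean_half_line
  unfolding points_half_line unfolding half_line_def
  by (auto simp: openin_open_subtopology openin_Euclidean_1[unfolded One_nat_def])

lemma smooth_real_cong:
  assumes "\<And>t. t \<in> T \<Longrightarrow> F t = G t"
  shows "smooth_real T F \<longleftrightarrow> smooth_real T G"
  unfolding smooth_real_def
  using times_differentiable_cong[of _ T F G] times_differentiable_cong[of _ T G F] assms by auto

lemma smooth_on_half_line:
  "smooth_on half_line U f \<longleftrightarrow>
     U \<subseteq> points half_line \<and> smooth_real {t. line t \<in> U} (\<lambda>t. f (line t))"
proof (cases "openin (mtop half_line) U")
  case True
  then have U: "U \<subseteq> line ` {0<..}" by (simp add: openin_half_line points_half_line)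
  then have [simp]: "U \<inter> line ` {0<..} = U" by blast
  have "smooth_on half_line U f \<longleftrightarrow>
      smooth_euclidean 1 U (\<lambda>x. f (inv_into (line ` {0<..}) (\<lambda>x. x) x))"
    using True by (simp add: smooth_on_def half_line_def)
  also have "\<dots> \<longleftrightarrow> smooth_real {t. line t \<in> U} (\<lambda>t. f (inv_into (line ` {0<..}) (\<lambda>x. x) (line t)))"
    unfolding smooth_euclidean_1 using U by auto
  also have "\<dots> \<longleftrightarrow> smooth_real {t. line t \<in> U} (\<lambda>t. f (line t))"
  proof (rule smooth_real_cong)
    fix t assume "t \<in> {t. line t \<in> U}"
    then have "inv_into (line ` {0<..}) (\<lambda>x. x) (line t) = line t"
      using U f_inv_into_f[of "line t" "\<lambda>x. x" "line ` {0<..}"] by auto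
    then show "f (inv_into (line ` {0<..}) (\<lambda>x. x) (line t)) = f (line t)" by simp
  qed
  finally show ?thesis using U by (simp add: points_half_line)
next
  case False
  then show ?thesis by (auto simp: smooth_on_def openin_half_line smooth_real_def)
qed

lemma smooth_manifold_half_line: "smooth_manifold half_line"
proof -
  have "second_countable (euclidean :: (nat \<Rightarrow> real) topology)"
  proof -
    obtain B :: "(nat \<Rightarrow> real) set set" where B: "countable B" "\<And>C. C \<in> B \<Longrightarrow> open C"
      "\<And>S. open S \<Longrightarrow> \<exists>U. U \<subseteq> B \<and> S = \<Union>U"
      by (rule univ_second_countable) blast
    have "\<exists>V\<in>B. x \<in> V \<and> V \<subseteq> S" if "open S" "x \<in> S" for S x
      using B(3)[OF that(1)] that(2) by blast
    with B(1,2) show ?thesis unfolding second_countable_def by (intro exI[of _ B]) simp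
  qed
  then have sc: "second_countable (mtop half_line)"
    unfolding half_line_def Euclidean_space_def
    by (simp add: euclidean_product_topology second_countable_subtopology)
  have haus: "Hausdorff_space (mtop half_line)"
    unfolding half_line_def by (simp add: Hausdorff_Euclidean_space Hausdorff_space_subtopology)
  have trans: "smooth_euclidean 1 (line ` {0<..}) (\<lambda>x. inv_into (line ` {0<..}) (\<lambda>x. x) x 0)"
    unfolding smooth_euclidean_1
  proof
    have "smooth_real {0<..} (\<lambda>t. t)" by (simp add: smooth_real_def times_differentiable_id)
    then show "smooth_real {t. line t \<in> line ` {0<..}}
       (\<lambda>t. inv_into (line ` {0<..}) (\<lambda>x. x) (line t) 0)"
      by (subst smooth_real_cong[where G="\<lambda>t. t"])
         (auto simp: f_inv_into_f[where f = "\<lambda>x. x"] greaterThan_def[symmetric])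
  qed auto
  have *: "mdim half_line = 1" "atlas half_line = {(line ` {0<..}, \<lambda>x. x)}"
     "mtop half_line = subtopology (Euclidean_space 1) (line ` {0<..})" by (auto simp: half_line_def)
  have id: "homeomorphic_map X X (\<lambda>x. x)" for X :: "(nat \<Rightarrow> real) topology"
    using homeomorphic_map_id[of X X] by (simp add: id_def)
  have "openin (mtop half_line) (line ` {0<..})"
    unfolding openin_half_line points_half_line by (simp add: greaterThan_def[symmetric])
  then show ?thesis
    unfolding smooth_manifold_def points_half_line
    using sc haus trans openin_Euclidean_half_line
    by (simp add: * subtopology_subtopology id)
qed

section \<open>Differentiation on the half-line\<close>

definition coord :: "(nat \<Rightarrow> real) \<Rightarrow> real" where
  "coord x = x 0"

definition ddx :: "((nat \<Rightarrow> real) \<Rightarrow> real) \<Rightarrow> (nat \<Rightarrow> real) \<Rightarrow> real" where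
  "ddx f p = deriv (\<lambda>t. f (line t)) (coord p)"

lemma coord_line [simp]: "coord (line t) = t"
  by (simp add: coord_def)

lemma line_coord: "p \<in> points half_line \<Longrightarrow> line (coord p) = p"
  by (auto simp: points_half_line)

lemma coord_pos: "p \<in> points half_line \<Longrightarrow> 0 < coord p"
  by (auto simp: points_half_line)

lemma line_in_points [simp]: "line t \<in> points half_line \<longleftrightarrow> 0 < t"
  by (simp add: points_half_line)

lemma smooth_on_open: "smooth_on half_line U f \<Longrightarrow> openin (mtop half_line) U"
  by (simp add: smooth_on_def)

lemma smooth_on_cong:
  assumes "\<And>q. q \<in> U \<Longrightarrow> f q = h q"
  shows "smooth_on half_line U f \<longleftrightarrow> smooth_on half_line U h"
  unfolding smooth_on_half_line using smooth_real_cong[of "{t. line t \<in> U}" "\<lambda>t. f (line t)"] assms by auto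

lemma smooth_on_subset:
  assumes "smooth_on half_line U f" "openin (mtop half_line) V" "V \<subseteq> U"
  shows "smooth_on half_line V f"
proof -
  have "times_differentiable k {t. line t \<in> V} (\<lambda>t. f (line t))" for k
    by (rule times_differentiable_subset[of _ "{t. line t \<in> U}"])
       (use assms in \<open>auto simp: smooth_on_half_line smooth_real_def\<close>)
  then show ?thesis using assms(2) by (simp add: smooth_on_half_line openin_half_line smooth_real_def)
qed

lemma smooth_on_const: "openin (mtop half_line) U \<Longrightarrow> smooth_on half_line U (\<lambda>q. c)"
  by (simp add: smooth_on_half_line openin_half_line smooth_real_def times_differentiable_const)

lemma smooth_on_coord: "openin (mtop half_line) U \<Longrightarrow> smooth_on half_line U coord"
  by (simp add: smooth_on_half_line openin_half_line smooth_real_def times_differentiable_id)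

lemma smooth_on_add:
  "smooth_on half_line U f \<Longrightarrow> smooth_on half_line U h \<Longrightarrow> smooth_on half_line U (\<lambda>q. f q + h q)"
  by (simp add: smooth_on_half_line smooth_real_def times_differentiable_add)

lemma smooth_on_mult:
  "smooth_on half_line U f \<Longrightarrow> smooth_on half_line U h \<Longrightarrow> smooth_on half_line U (\<lambda>q. f q * h q)"
  by (simp add: smooth_on_half_line smooth_real_def times_differentiable_mult)

lemma smooth_on_powr:
  assumes "openin (mtop half_line) U"
  shows "smooth_on half_line U (\<lambda>q. coord q powr a)"
proof -
  have "{t. line t \<in> U} \<subseteq> {0<..}" using assms by (auto simp: openin_half_line)
  then show ?thesis
    using assms by (simp add: smooth_on_half_line openin_half_line smooth_real_def times_differentiable_powr)
qed

lemma smooth_on_ddx: "smooth_on half_line U f \<Longrightarrow> smooth_on half_line U (ddx f)"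
  using smooth_real_deriv[of "{t. line t \<in> U}" "\<lambda>t. f (line t)"]
  by (simp add: smooth_on_half_line ddx_def)

lemma has_derivative_ddx:
  assumes "smooth_on half_line U f" "p \<in> U"
  shows "((\<lambda>t. f (line t)) has_real_derivative ddx f p) (at (coord p))"
proof -
  have "line (coord p) = p" using assms line_coord by (auto simp: smooth_on_half_line)
  then show ?thesis unfolding ddx_def
    using assms by (intro smooth_real_has_derivative[of "{t. line t \<in> U}"]) (auto simp: smooth_on_half_line)
qed

lemma ddx_eqI: "((\<lambda>t. f (line t)) has_real_derivative D) (at (coord p)) \<Longrightarrow> ddx f p = D"
  unfolding ddx_def by (rule DERIV_imp_deriv)

lemma ddx_cong:
  assumes "openin (mtop half_line) U" "p \<in> U" "\<And>q. q \<in> U \<Longrightarrow> f q = h q"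
  shows "ddx f p = ddx h p"
  unfolding ddx_def
proof (rule deriv_cong_ev)
  have "open {t. line t \<in> U}" "coord p \<in> {t. line t \<in> U}"
    using assms(1,2) line_coord by (auto simp: openin_half_line)
  then have "\<forall>\<^sub>F t in nhds (coord p). t \<in> {t. line t \<in> U}" by (rule eventually_nhds_in_open)
  then show "\<forall>\<^sub>F t in nhds (coord p). f (line t) = h (line t)"
    by eventually_elim (use assms(3) in auto)
qed simp

lemma ddx_const: "ddx (\<lambda>q. c) p = 0"
  by (rule ddx_eqI) simp

lemma ddx_coord: "ddx coord p = 1"
  by (rule ddx_eqI) simp

lemma ddx_add:
  assumes "smooth_on half_line U f" "smooth_on half_line U h" "p \<in> U"
  shows "ddx (\<lambda>q. f q + h q) p = ddx f p + ddx h p"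
  using assms by (intro ddx_eqI DERIV_add has_derivative_ddx)

lemma ddx_mult:
  assumes "smooth_on half_line U f" "smooth_on half_line U h" "p \<in> U"
  shows "ddx (\<lambda>q. f q * h q) p = ddx f p * h p + f p * ddx h p"
proof -
  have "line (coord p) = p" using assms line_coord by (auto simp: smooth_on_half_line)
  then show ?thesis
    using DERIV_mult[OF has_derivative_ddx[OF assms(1,3)] has_derivative_ddx[OF assms(2,3)]]
    by (intro ddx_eqI) (simp add: algebra_simps)
qed

lemma ddx_powr:
  assumes "p \<in> points half_line"
  shows "ddx (\<lambda>q. coord q powr a) p = a * coord p powr (a - 1)"
  using has_real_derivative_powr[OF coord_pos[OF assms], of a] by (intro ddx_eqI) simp

definition dilation :: "real \<Rightarrow> (nat \<Rightarrow> real) \<Rightarrow> nat \<Rightarrow> real" where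
  "dilation c x = line (c * coord x)"

lemma smooth_on_dilation:
  assumes "smooth_on half_line W f" "0 < c"
  shows "smooth_on half_line {x \<in> points half_line. dilation c x \<in> W} (\<lambda>x. f (dilation c x))"
proof -
  have W: "W \<subseteq> points half_line" using assms by (simp add: smooth_on_half_line)
  have "0 < t" if "line (c * t) \<in> W" for t
    using that W assms(2) by (metis line_in_points subset_iff zero_less_mult_pos)
  then have eq: "{t. line t \<in> {x \<in> points half_line. dilation c x \<in> W}} = {t. c * t \<in> {t. line t \<in> W}}"
    by (auto simp: dilation_def)
  have "open {t. c * t \<in> {t. line t \<in> W}}"
    using assms(1) open_vimage[of "{t. line t \<in> W}" "\<lambda>t. c * t"]
    by (auto simp: smooth_on_half_line smooth_real_def vimage_def intro: continuous_intros)
  then show ?thesis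
    using assms(1) times_differentiable_scaled[of _ "{t. line t \<in> W}" "\<lambda>t. f (line t)" c]
    unfolding smooth_on_half_line eq by (auto simp: smooth_real_def dilation_def)
qed

lemma ddx_dilation:
  assumes "smooth_on half_line W f" "dilation c p \<in> W"
  shows "ddx (\<lambda>x. f (dilation c x)) p = c * ddx f (dilation c p)"
proof (rule ddx_eqI)
  have "((\<lambda>t. f (line t)) has_real_derivative ddx f (dilation c p)) (at (c * coord p))"
    using has_derivative_ddx[OF assms] by (simp add: dilation_def)
  then have "((\<lambda>t. f (line (c * t))) has_real_derivative ddx f (dilation c p) * c) (at (coord p))"
    by (rule DERIV_chain2) (auto intro!: derivative_eq_intros)
  then show "((\<lambda>t. f (dilation c (line t))) has_real_derivative c * ddx f (dilation c p)) (at (coord p))"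
    by (simp add: dilation_def mult.commute)
qed

section \<open>Tangent vectors and vector fields on the half-line\<close>

text \<open>The vector \<open>a d/dx\<close> at \<open>p\<close>, extended by 0 to functions that are not smooth near \<open>p\<close>.\<close>

definition tan_vec :: "(nat \<Rightarrow> real) \<Rightarrow> real \<Rightarrow> (nat \<Rightarrow> real) tvec" where
  "tan_vec p a = (\<lambda>f. if smooth_near half_line p f then a * ddx f p else 0)"

lemma smooth_nearI: "smooth_on half_line U f \<Longrightarrow> p \<in> U \<Longrightarrow> smooth_near half_line p f"
  unfolding smooth_near_def by blast

lemma tan_vec_apply: "smooth_on half_line U f \<Longrightarrow> p \<in> U \<Longrightarrow> tan_vec p a f = a * ddx f p"
  by (simp add: tan_vec_def smooth_nearI)

lemma tan_vec_add: "tan_vec p (a + b) = (\<lambda>f. tan_vec p a f + tan_vec p b f)"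
  by (auto simp: tan_vec_def algebra_simps)

lemma tan_vec_diff: "tan_vec p (a - b) = (\<lambda>f. tan_vec p a f - tan_vec p b f)"
  by (auto simp: tan_vec_def algebra_simps)

lemma tan_vec_scale: "tan_vec p (c * a) = (\<lambda>f. c * tan_vec p a f)"
  by (auto simp: tan_vec_def)

lemma openin_points: "openin (mtop half_line) (points half_line)"
  by simp

lemma tan_vec_coord: "p \<in> points half_line \<Longrightarrow> tan_vec p a coord = a"
  using tan_vec_apply[OF smooth_on_coord[OF openin_points]] by (simp add: ddx_coord)

lemma smooth_near_common:
  assumes "smooth_near half_line p f" "smooth_near half_line p h"
  obtains U where "smooth_on half_line U f" "smooth_on half_line U h" "p \<in> U"
proof -
  obtain U V where *: "smooth_on half_line U f" "smooth_on half_line V h" "p \<in> U" "p \<in> V"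
    using assms by (auto simp: smooth_near_def)
  have "openin (mtop half_line) (U \<inter> V)" using * smooth_on_open openin_Int by blast
  then show thesis
    using * that[of "U \<inter> V"] smooth_on_subset[of _ _ "U \<inter> V"] by auto
qed

lemma tan_vec_in_tangent_space: "tan_vec p a \<in> tangent_space half_line p"
  unfolding tangent_space_def
proof (intro CollectI conjI allI impI)
  fix f h assume "smooth_near half_line p f \<and> smooth_near half_line p h"
  then obtain U where U: "smooth_on half_line U f" "smooth_on half_line U h" "p \<in> U"
    using smooth_near_common by blast
  note * = tan_vec_apply[OF U(1,3)] tan_vec_apply[OF U(2,3)]
  show "tan_vec p a (\<lambda>x. f x + h x) = tan_vec p a f + tan_vec p a h"
    using tan_vec_apply[OF smooth_on_add[OF U(1,2)] U(3)] ddx_add[OF U]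
    by (simp add: * algebra_simps)
  show "tan_vec p a (\<lambda>x. f x * h x) = f p * tan_vec p a h + h p * tan_vec p a f"
    using tan_vec_apply[OF smooth_on_mult[OF U(1,2)] U(3)] ddx_mult[OF U]
    by (simp add: * algebra_simps)
next
  fix c f assume "smooth_near half_line p f"
  then obtain U where U: "smooth_on half_line U f" "p \<in> U" by (auto simp: smooth_near_def)
  note c = smooth_on_const[OF smooth_on_open[OF U(1)]]
  show "tan_vec p a (\<lambda>x. c * f x) = c * tan_vec p a f"
    using tan_vec_apply[OF smooth_on_mult[OF c U(1)] U(2)] ddx_mult[OF c U] tan_vec_apply[OF U]
    by (simp add: ddx_const)
next
  fix U f h
  assume *: "openin (mtop half_line) U \<and> p \<in> U \<and> smooth_on half_line U f \<and> (\<forall>x\<in>U. f x = h x)"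
  then have "smooth_on half_line U h" using smooth_on_cong[of U f h] by blast
  moreover have "ddx f p = ddx h p" using * by (intro ddx_cong[of U]) auto
  ultimately show "tan_vec p a f = tan_vec p a h" using * tan_vec_apply by metis
qed (simp add: tan_vec_def)

text \<open>Every tangent vector is a multiple of \<open>d/dx\<close>. By Hadamard's lemma a function \<open>f\<close> equals
  \<open>f p + (x - p) g x\<close> near \<open>p\<close> with \<open>g\<close> smooth; a derivation kills constants, so the Leibniz rule
  leaves \<open>g p\<close> times its value on the coordinate, and \<open>g p\<close> is the derivative of \<open>f\<close> at \<open>p\<close>.\<close>

lemma tangent_space_half_line:
  assumes v: "v \<in> tangent_space half_line p" and p: "p \<in> points half_line"
  shows "v = tan_vec p (v coord)"
proof
  fix f
  note v' = v[unfolded tangent_space_def mem_Collect_eq]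
  note add = v'[THEN conjunct1, rule_format, OF conjI, THEN conjunct1]
  note mult = v'[THEN conjunct1, rule_format, OF conjI, THEN conjunct2]
  note scale = v'[THEN conjunct2, THEN conjunct1, rule_format]
  note zero = v'[THEN conjunct2, THEN conjunct2, THEN conjunct2, rule_format]
  have loc: "v f = v h" if "smooth_on half_line U f" "p \<in> U" "\<And>x. x \<in> U \<Longrightarrow> f x = h x" for U f h
    by (rule v'[THEN conjunct2, THEN conjunct2, THEN conjunct1, rule_format, of U])
       (use that smooth_on_open in blast)
  show "v f = tan_vec p (v coord) f"
  proof (cases "smooth_near half_line p f")
    case False
    then show ?thesis by (simp add: zero tan_vec_def)
  next
    case True
    then obtain U where U: "smooth_on half_line U f" "p \<in> U" by (auto simp: smooth_near_def)
    have "open {t. line t \<in> U}" "coord p \<in> {t. line t \<in> U}"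
      using U p line_coord by (auto simp: smooth_on_half_line smooth_real_def)
    then obtain e where e: "e > 0" "ball (coord p) e \<subseteq> {t. line t \<in> U}"
      using openE by blast
    define W where "W = line ` ball (coord p) e"
    have WU: "W \<subseteq> U" using e by (auto simp: W_def)
    have tW: "{t. line t \<in> W} = ball (coord p) e" by (auto simp: W_def)
    have W: "openin (mtop half_line) W"
      using WU smooth_on_open[OF U(1)] unfolding openin_half_line tW by auto
    have pW: "p \<in> W" using e line_coord[OF p] by (metis W_def centre_in_ball imageI)
    have fW: "smooth_on half_line W f" by (rule smooth_on_subset[OF U(1) W WU])
    then have "smooth_real (ball (coord p) e) (\<lambda>t. f (line t))" by (simp add: smooth_on_half_line tW)
    from hadamard[OF this convex_ball centre_in_ball[THEN iffD2, OF e(1)]]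
    obtain G where G: "smooth_real (ball (coord p) e) G"
      "\<And>t. t \<in> ball (coord p) e \<Longrightarrow> f (line t) = f (line (coord p)) + (t - coord p) * G t"
      "G (coord p) = ddx f p"
      unfolding ddx_def by blast
    define g where "g x = G (coord x)" for x
    have g: "smooth_on half_line W g"
      using G(1) W by (simp add: smooth_on_half_line openin_half_line tW g_def)
    \<comment> \<open>The constants are written as multiples of 1 so that the scaling rule of a derivation applies.\<close>
    have feq: "f x = f p * 1 + (coord x + - coord p * 1) * g x" if "x \<in> W" for x
      using that G(2) by (auto simp: W_def g_def line_coord[OF p])
    have sc: "smooth_near half_line p (\<lambda>x. c)" for c
      using smooth_nearI[OF smooth_on_const[OF W] pW] .
    have sg: "smooth_near half_line p g" using smooth_nearI[OF g pW] .
    have sx: "smooth_near half_line p coord" using smooth_nearI[OF smooth_on_coord[OF W] pW] .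
    have sxc: "smooth_near half_line p (\<lambda>x. coord x + - coord p * 1)"
      using smooth_nearI[OF smooth_on_add[OF smooth_on_coord[OF W] smooth_on_const[OF W]] pW] .
    have sxg: "smooth_near half_line p (\<lambda>x. (coord x + - coord p * 1) * g x)"
      using smooth_nearI[OF smooth_on_mult[OF smooth_on_add[OF smooth_on_coord[OF W] smooth_on_const[OF W]] g] pW] .
    have "v (\<lambda>x. 1) = 0" using mult[OF sc sc, of 1 1] by simp
    then have vc: "v (\<lambda>x. c * 1) = 0" for c using scale[OF sc, of c 1] by simp
    have "v f = v (\<lambda>x. f p * 1 + (coord x + - coord p * 1) * g x)"
      by (rule loc[OF fW pW feq])
    also have "\<dots> = v (\<lambda>x. f p * 1) + v (\<lambda>x. (coord x + - coord p * 1) * g x)"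
      by (rule add[OF sc sxg])
    also have "\<dots> = g p * v (\<lambda>x. coord x + - coord p * 1)"
      using mult[OF sxc sg] by (simp only: vc) simp
    also have "\<dots> = g p * v coord"
      using add[OF sx sc, of "- coord p * 1"] by (simp only: vc) simp
    also have "\<dots> = tan_vec p (v coord) f"
      using tan_vec_apply[OF U] G(3) by (simp add: g_def)
    finally show ?thesis .
  qed
qed

text \<open>A vector field \<open>X\<close> is thus determined by its component \<open>\<lambda>q. X q coord\<close>, and all later
  computations take place in these components.\<close>

lemma vector_field_half_line:
  "vector_field half_line U X \<longleftrightarrow>
     smooth_on half_line U (\<lambda>q. X q coord) \<and> (\<forall>q\<in>U. X q = tan_vec q (X q coord))"
proof
  assume X: "vector_field half_line U X"
  then have U: "openin (mtop half_line) U" by (simp add: vector_field_def)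
  then have "smooth_on half_line U (\<lambda>q. X q coord)"
    using X smooth_on_coord unfolding vector_field_def by blast
  moreover have "X q = tan_vec q (X q coord)" if "q \<in> U" for q
    using X that U by (intro tangent_space_half_line) (auto simp: vector_field_def openin_half_line)
  ultimately show "smooth_on half_line U (\<lambda>q. X q coord) \<and> (\<forall>q\<in>U. X q = tan_vec q (X q coord))"
    by blast
next
  assume X: "smooth_on half_line U (\<lambda>q. X q coord) \<and> (\<forall>q\<in>U. X q = tan_vec q (X q coord))"
  show "vector_field half_line U X"
    unfolding vector_field_def
  proof (intro conjI ballI allI impI)
    show "openin (mtop half_line) U" using X smooth_on_open by blast
    show "X q \<in> tangent_space half_line q" if "q \<in> U" for q
      using X that tan_vec_in_tangent_space by metis
    fix V f assume V: "V \<subseteq> U \<and> smooth_on half_line V f"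
    have "X q f = X q coord * ddx f q" if "q \<in> V" for q
      using X V that tan_vec_apply by (metis subset_iff)
    moreover have "smooth_on half_line V (\<lambda>q. X q coord)"
      using smooth_on_subset[OF conjunct1[OF X]] V smooth_on_open by blast
    then have "smooth_on half_line V (\<lambda>q. X q coord * ddx f q)"
      using V by (intro smooth_on_mult smooth_on_ddx) auto
    ultimately show "smooth_on half_line V (\<lambda>q. X q f)"
      using smooth_on_cong[of V "\<lambda>q. X q f" "\<lambda>q. X q coord * ddx f q"] by simp
  qed
qed

lemma vector_field_smooth: "vector_field half_line U X \<Longrightarrow> smooth_on half_line U (\<lambda>q. X q coord)"
  by (simp add: vector_field_half_line)

lemma vector_field_open: "vector_field half_line U X \<Longrightarrow> openin (mtop half_line) U"
  by (simp add: vector_field_def)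

lemma vector_field_eq: "vector_field half_line U X \<Longrightarrow> q \<in> U \<Longrightarrow> X q = tan_vec q (X q coord)"
  by (simp add: vector_field_half_line)

lemma vector_field_in_points: "vector_field half_line U X \<Longrightarrow> q \<in> U \<Longrightarrow> q \<in> points half_line"
  using vector_field_open openin_half_line by blast

lemma vector_fieldI:
  assumes "smooth_on half_line U a" "\<And>q. q \<in> U \<Longrightarrow> X q = tan_vec q (a q)"
  shows "vector_field half_line U X"
proof -
  have "X q coord = a q" if "q \<in> U" for q
    using assms that tan_vec_coord smooth_on_open openin_half_line by (metis subset_iff)
  then show ?thesis
    unfolding vector_field_half_line using assms smooth_on_cong[of U "\<lambda>q. X q coord" a] by auto
qed

lemma vector_field_subset:
  assumes "vector_field half_line U X" "openin (mtop half_line) V" "V \<subseteq> U"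
  shows "vector_field half_line V X"
  using assms smooth_on_subset[of U _ V] unfolding vector_field_half_line by blast

lemma vector_field_apply:
  assumes "vector_field half_line U X" "smooth_on half_line V f" "p \<in> U" "p \<in> V"
  shows "X p f = X p coord * ddx f p"
  using vector_field_eq[OF assms(1,3)] tan_vec_apply[OF assms(2,4)] by metis

lemma ddx_vector_field:
  assumes X: "vector_field half_line U X" and f: "smooth_on half_line U f" and p: "p \<in> U"
  shows "ddx (\<lambda>q. X q f) p = ddx (\<lambda>q. X q coord) p * ddx f p + X p coord * ddx (ddx f) p"
proof -
  have "ddx (\<lambda>q. X q f) p = ddx (\<lambda>q. X q coord * ddx f q) p"
    using vector_field_apply[OF X f] by (intro ddx_cong[OF vector_field_open[OF X] p]) auto
  then show ?thesis using ddx_mult[OF vector_field_smooth[OF X] smooth_on_ddx[OF f] p] by simp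
qed

lemma bracket_half_line:
  assumes X: "vector_field half_line U X" and Y: "vector_field half_line U Y" and p: "p \<in> U"
  shows "bracket half_line X Y p =
    tan_vec p (X p coord * ddx (\<lambda>q. Y q coord) p - Y p coord * ddx (\<lambda>q. X q coord) p)"
proof
  fix f
  show "bracket half_line X Y p f =
    tan_vec p (X p coord * ddx (\<lambda>q. Y q coord) p - Y p coord * ddx (\<lambda>q. X q coord) p) f"
  proof (cases "smooth_near half_line p f")
    case False
    then show ?thesis by (simp add: bracket_def tan_vec_def)
  next
    case True
    then obtain U' where "smooth_on half_line U' f" "p \<in> U'" by (auto simp: smooth_near_def)
    moreover define V where "V = U \<inter> U'"
    ultimately have V: "openin (mtop half_line) V" "V \<subseteq> U" "p \<in> V" "smooth_on half_line V f"
      using p vector_field_open[OF X] smooth_on_open smooth_on_subset[of U' f V] by auto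
    note X' = vector_field_subset[OF X V(1,2)] and Y' = vector_field_subset[OF Y V(1,2)]
    have "smooth_on half_line V (\<lambda>q. X q f)" "smooth_on half_line V (\<lambda>q. Y q f)"
      using X' Y' V(4) unfolding vector_field_def by blast+
    then have "X p (\<lambda>q. Y q f) = X p coord * ddx (\<lambda>q. Y q f) p"
      "Y p (\<lambda>q. X q f) = Y p coord * ddx (\<lambda>q. X q f) p"
      using vector_field_apply X' Y' V(3) by blast+
    then show ?thesis
      using True tan_vec_apply[OF V(4,3)] ddx_vector_field[OF X' V(4,3)] ddx_vector_field[OF Y' V(4,3)]
      by (simp add: bracket_def algebra_simps)
  qed
qed

lemma vector_field_apply_smooth:
  assumes "vector_field half_line U X" "smooth_on half_line U f"
  shows "smooth_on half_line U (\<lambda>q. X q f)"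
  using assms(1)[unfolded vector_field_def, THEN conjunct2, THEN conjunct2, rule_format, of U f] assms(2)
  by simp

section \<open>The flat connection\<close>

text \<open>The covariant derivative differentiates components: \<open>d/dx\<close> is parallel.\<close>

definition line_conn :: "(nat \<Rightarrow> real) conn" where
  "line_conn p v Y = tan_vec p (v (\<lambda>q. Y q coord))"

lemma line_conn_half_line:
  assumes "vector_field half_line U Y" "p \<in> U" "v \<in> tangent_space half_line p"
  shows "line_conn p v Y = tan_vec p (v coord * ddx (\<lambda>q. Y q coord) p)"
proof -
  have "v = tan_vec p (v coord)"
    using assms vector_field_in_points by (intro tangent_space_half_line)
  then have "v (\<lambda>q. Y q coord) = v coord * ddx (\<lambda>q. Y q coord) p"
    using tan_vec_apply[OF vector_field_smooth[OF assms(1)] assms(2)] by metis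
  then show ?thesis by (simp add: line_conn_def)
qed

lemma line_conn_fields:
  assumes "vector_field half_line U X" "vector_field half_line U Y" "p \<in> U"
  shows "line_conn p (X p) Y = tan_vec p (X p coord * ddx (\<lambda>q. Y q coord) p)"
  using assms by (intro line_conn_half_line) (auto simp: vector_field_def)

lemma vector_field_line_conn:
  assumes X: "vector_field half_line U X" and Y: "vector_field half_line U Y"
  shows "vector_field half_line U (\<lambda>p. line_conn p (X p) Y)"
  by (rule vector_fieldI[OF smooth_on_mult[OF vector_field_smooth[OF X]
        smooth_on_ddx[OF vector_field_smooth[OF Y]]] line_conn_fields[OF X Y]])

lemma connection_line_conn: "connection half_line line_conn"
  unfolding connection_def
proof (intro conjI allI impI ballI)
  fix U Y p v
  assume "vector_field half_line U Y \<and> p \<in> U" and v: "v \<in> tangent_space half_line p"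
  then have Y: "vector_field half_line U Y" and p: "p \<in> U" by auto
  note Ys = vector_field_smooth[OF Y] and U = vector_field_open[OF Y]
  note veq = tangent_space_half_line[OF v vector_field_in_points[OF Y p]]
  show "line_conn p v Y \<in> tangent_space half_line p"
    by (simp add: line_conn_def tan_vec_in_tangent_space)
  show "line_conn p (\<lambda>f. v f + w f) Y = (\<lambda>f. line_conn p v Y f + line_conn p w Y f)" for w
    by (simp add: line_conn_def tan_vec_add)
  show "line_conn p (\<lambda>f. c * v f) Y = (\<lambda>f. c * line_conn p v Y f)" for c
    by (simp add: line_conn_def tan_vec_scale)
  show "line_conn p v (\<lambda>q f. Y q f + Z q f) = (\<lambda>f. line_conn p v Y f + line_conn p v Z f)"
    if Z: "vector_field half_line U Z" for Z
  proof -
    have "v (\<lambda>q. Y q coord + Z q coord) = v (\<lambda>q. Y q coord) + v (\<lambda>q. Z q coord)"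
      using v smooth_nearI[OF Ys p] smooth_nearI[OF vector_field_smooth[OF Z] p]
      by (simp add: tangent_space_def)
    then show ?thesis by (simp add: line_conn_def tan_vec_add)
  qed
  show "line_conn p v (\<lambda>q f. a q * Y q f) = (\<lambda>f. v a * Y p f + a p * line_conn p v Y f)"
    if a: "smooth_on half_line U a" for a
  proof -
    have "v (\<lambda>q. a q * Y q coord) = v a * Y p coord + a p * v (\<lambda>q. Y q coord)"
      using v smooth_nearI[OF Ys p] smooth_nearI[OF a p]
      by (simp add: tangent_space_def)
    then have "line_conn p v (\<lambda>q f. a q * Y q f) =
        (\<lambda>f. v a * tan_vec p (Y p coord) f + a p * line_conn p v Y f)"
      by (simp add: line_conn_def tan_vec_add tan_vec_scale)
    then show ?thesis using vector_field_eq[OF Y p] by metis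
  qed
  show "line_conn p v Z = line_conn p v Y" if Z: "\<forall>q\<in>U. Z q = Y q" for Z
  proof -
    have "vector_field half_line U Z"
      using Z vector_field_eq[OF Y] by (intro vector_fieldI[OF Ys]) simp
    moreover have "ddx (\<lambda>q. Z q coord) p = ddx (\<lambda>q. Y q coord) p"
      using Z by (intro ddx_cong[OF U p]) simp
    ultimately show ?thesis using line_conn_half_line[OF _ p v] Y by simp
  qed
next
  fix U X Y
  assume "vector_field half_line U X \<and> vector_field half_line U Y"
  then show "vector_field half_line U (\<lambda>p. line_conn p (X p) Y)"
    by (intro vector_field_line_conn) auto
qed

lemma torsion_free_line_conn: "torsion_free half_line line_conn"
  unfolding torsion_free_def
proof (intro allI impI ballI)
  fix U X Y p f
  assume "vector_field half_line U X \<and> vector_field half_line U Y" and p: "p \<in> U"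
  then have X: "vector_field half_line U X" and Y: "vector_field half_line U Y" by auto
  show "line_conn p (X p) Y f - line_conn p (Y p) X f - bracket half_line X Y p f = 0"
    by (simp add: line_conn_fields[OF X Y p] line_conn_fields[OF Y X p] bracket_half_line[OF X Y p] tan_vec_diff)
qed

text \<open>Since \<open>d/dx\<close> is parallel, the component of an iterated covariant derivative of \<open>Z\<close> is the iterated
  directional derivative of the component of \<open>Z\<close>. The curvature vanishes because the bracket is the
  commutator of directional derivatives.\<close>

lemma flat_line_conn: "flat half_line line_conn"
  unfolding flat_def
proof (intro allI impI ballI)
  fix U X Y Z p f
  assume "vector_field half_line U X \<and> vector_field half_line U Y \<and> vector_field half_line U Z" and p: "p \<in> U"
  then have X: "vector_field half_line U X" and Y: "vector_field half_line U Y"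
    and Z: "vector_field half_line U Z" by auto
  let ?z = "\<lambda>q. Z q coord"
  note zs = vector_field_smooth[OF Z]
  have second: "line_conn p (V p) (\<lambda>q. line_conn q (W q) Z) = tan_vec p (V p (\<lambda>q. W q ?z))"
    if V: "vector_field half_line U V" and W: "vector_field half_line U W" for V W
  proof -
    have "line_conn q (W q) Z coord = W q ?z" if "q \<in> U" for q
      using that tan_vec_coord[OF vector_field_in_points[OF Z that]] by (simp add: line_conn_def)
    then have "ddx (\<lambda>q. line_conn q (W q) Z coord) p = ddx (\<lambda>q. W q ?z) p"
      by (intro ddx_cong[OF vector_field_open[OF Z] p])
    moreover have "vector_field half_line U (\<lambda>q. line_conn q (W q) Z)"
      by (rule vector_field_line_conn[OF W Z])
    moreover have "smooth_on half_line U (\<lambda>q. W q ?z)"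
      by (rule vector_field_apply_smooth[OF W zs])
    ultimately show ?thesis
      by (simp only: line_conn_fields[OF V _ p] vector_field_apply[OF V _ p p])
  qed
  have "line_conn p (bracket half_line X Y p) Z = tan_vec p (X p (\<lambda>q. Y q ?z) - Y p (\<lambda>q. X q ?z))"
    using smooth_nearI[OF zs p] by (simp add: line_conn_def bracket_def)
  then show "line_conn p (X p) (\<lambda>q. line_conn q (Y q) Z) f - line_conn p (Y p) (\<lambda>q. line_conn q (X q) Z) f -
       line_conn p (bracket half_line X Y p) Z f = 0"
    by (simp add: second[OF X Y] second[OF Y X] tan_vec_diff)
qed

section \<open>The Euler field and its flow\<close>

definition euler_field :: "(nat \<Rightarrow> real) vfield" where
  "euler_field p = tan_vec p (coord p)"

lemma vector_field_scaled_euler: "vector_field half_line (points half_line) (\<lambda>p f. l * euler_field p f)"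
proof (rule vector_fieldI)
  show "smooth_on half_line (points half_line) (\<lambda>p. l * coord p)"
    by (intro smooth_on_mult smooth_on_const smooth_on_coord openin_points)
qed (simp add: euler_field_def tan_vec_scale)

lemma radiant_euler_field: "radiant_vector_field half_line line_conn euler_field"
  unfolding radiant_vector_field_def
proof (intro conjI ballI)
  show E: "vector_field half_line (points half_line) euler_field"
    using vector_field_scaled_euler[of 1] by simp
  fix p v assume p: "p \<in> points half_line" and v: "v \<in> tangent_space half_line p"
  have "ddx (\<lambda>q. euler_field q coord) p = ddx coord p"
    by (intro ddx_cong[OF openin_points p]) (simp add: euler_field_def tan_vec_coord)
  then show "line_conn p v euler_field = v"
    using line_conn_half_line[OF E p v] tangent_space_half_line[OF v p] by (simp add: ddx_coord)
qed

text \<open>The coordinate of an integral curve satisfies the equation \<open>u' = l * u\<close>, hence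
  \<open>exp (- l * s) * u s\<close> is constant on the time interval: every local flow acts by dilations.\<close>

lemma local_flow_euler:
  assumes flow: "local_flow half_line (\<lambda>p f. l * euler_field p f) I U \<theta>" and t: "t \<in> I" and p: "p \<in> U"
  shows "\<theta> t p = dilation (exp (l * t)) p"
proof -
  define w where "w s = exp (- (l * s)) * coord (\<theta> s p)" for s
  have I: "convex I" "0 \<in> I" using flow by (auto simp: local_flow_def is_interval_convex)
  have pts: "\<theta> s p \<in> points half_line" if "s \<in> I" for s
    using flow p that by (auto simp: local_flow_def continuous_map_def Pi_iff)
  have "(w has_real_derivative 0) (at s)" if s: "s \<in> I" for s
  proof -
    have "smooth_near half_line (\<theta> s p) coord"
      by (rule smooth_nearI[OF smooth_on_coord[OF openin_points] pts[OF s]])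
    then have "((\<lambda>s. coord (\<theta> s p)) has_real_derivative l * euler_field (\<theta> s p) coord) (at s)"
      using flow p s by (simp add: local_flow_def)
    then have "((\<lambda>s. coord (\<theta> s p)) has_real_derivative l * coord (\<theta> s p)) (at s)"
      using tan_vec_coord[OF pts[OF s]] by (simp add: euler_field_def)
    moreover have "((\<lambda>s. exp (- (l * s))) has_real_derivative - l * exp (- (l * s))) (at s)"
      by (auto intro!: derivative_eq_intros)
    ultimately have "(w has_real_derivative
        - l * exp (- (l * s)) * coord (\<theta> s p) + l * coord (\<theta> s p) * exp (- (l * s))) (at s)"
      unfolding w_def by (intro DERIV_mult)
    then show ?thesis by (simp add: algebra_simps)
  qed
  then obtain c where "\<And>s. s \<in> I \<Longrightarrow> w s = c"
    using has_field_derivative_zero_constant[OF I(1), of w] has_field_derivative_at_within by metis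
  then have "w t = w 0" using t I(2) by simp
  moreover have "\<theta> 0 p = p" using flow p by (simp add: local_flow_def)
  ultimately have "coord (\<theta> t p) = exp (l * t) * coord p"
    by (simp add: w_def exp_minus field_simps)
  then show ?thesis using line_coord[OF pts[OF t]] by (simp add: dilation_def)
qed

lemma pushforward_dilation:
  assumes U: "openin (mtop half_line) U" and p: "p \<in> U" and c: "0 < c"
    and \<theta>: "\<And>q. q \<in> U \<Longrightarrow> \<theta> q = dilation c q"
  shows "pushforward half_line \<theta> p (tan_vec p a) = tan_vec (\<theta> p) (c * a)"
proof
  fix f
  show "pushforward half_line \<theta> p (tan_vec p a) f = tan_vec (\<theta> p) (c * a) f"
  proof (cases "smooth_near half_line (\<theta> p) f")
    case False
    then show ?thesis by (simp add: pushforward_def tan_vec_def)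
  next
    case True
    then obtain W where W: "smooth_on half_line W f" "\<theta> p \<in> W" by (auto simp: smooth_near_def)
    define V where "V = U \<inter> {x \<in> points half_line. dilation c x \<in> W}"
    note sd = smooth_on_dilation[OF W(1) c]
    have V: "openin (mtop half_line) V" unfolding V_def using U smooth_on_open[OF sd] by blast
    have pV: "p \<in> V" using p W(2) U \<theta>[OF p] by (auto simp: V_def openin_half_line)
    have eq: "f (\<theta> x) = f (dilation c x)" if "x \<in> V" for x using that \<theta> by (simp add: V_def)
    have "smooth_on half_line V (\<lambda>x. f (dilation c x))"
      by (rule smooth_on_subset[OF sd V]) (simp add: V_def)
    then have "smooth_on half_line V (\<lambda>x. f (\<theta> x))"
      using smooth_on_cong[of V "\<lambda>x. f (\<theta> x)" "\<lambda>x. f (dilation c x)"] eq by simp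
    then have "tan_vec p a (\<lambda>x. f (\<theta> x)) = a * ddx (\<lambda>x. f (\<theta> x)) p"
      using pV by (rule tan_vec_apply)
    also have "ddx (\<lambda>x. f (\<theta> x)) p = ddx (\<lambda>x. f (dilation c x)) p"
      using V pV eq by (rule ddx_cong)
    also have "\<dots> = c * ddx f (\<theta> p)"
      using ddx_dilation[of W f c p] W \<theta>[OF p] by simp
    finally show ?thesis using True tan_vec_apply[OF W] by (simp add: pushforward_def)
  qed
qed

lemma dilation_inverse: "p \<in> points half_line \<Longrightarrow> 0 < c \<Longrightarrow> dilation (1 / c) (dilation c p) = p"
  by (simp add: dilation_def line_coord)

text \<open>A dilation by \<open>c\<close> multiplies the components of vectors by \<open>c\<close>. The pushed forward field has
  component \<open>c * y (x / c)\<close> at \<open>x\<close>, where \<open>y\<close> is the component of \<open>Y\<close>; the inner derivative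
  \<open>1 / c\<close> cancels the factor \<open>c\<close>, which leaves one factor \<open>c\<close> from the pushed forward direction
  on both sides.\<close>

lemma flow_preserves_euler: "flow_preserves half_line line_conn (\<lambda>p f. l * euler_field p f)"
  unfolding flow_preserves_def
proof (intro allI impI ballI)
  fix I U \<theta> t Y p v
  assume flow: "local_flow half_line (\<lambda>p f. l * euler_field p f) I U \<theta>" and t: "t \<in> I"
    and Y: "vector_field half_line U Y" and p: "p \<in> U" and v: "v \<in> tangent_space half_line p"
  define c where "c = exp (l * t)"
  have c: "0 < c" by (simp add: c_def)
  have \<theta>: "\<theta> t q = dilation c q" if "q \<in> U" for q
    using local_flow_euler[OF flow t that] by (simp add: c_def)
  note U = vector_field_open[OF Y]
  have Up: "U \<subseteq> points half_line" using U by (simp add: openin_half_line)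
  note push = pushforward_dilation[OF U _ c, of _ "\<theta> t", OF _ \<theta>]
  define Y' where "Y' = (\<lambda>q. let r = inv_into U (\<theta> t) q in pushforward half_line (\<theta> t) r (Y r))"
  let ?y = "\<lambda>q. Y q coord"
  define V where "V = {x \<in> points half_line. dilation (1 / c) x \<in> U}"
  have sd: "smooth_on half_line V (\<lambda>x. ?y (dilation (1 / c) x))"
    unfolding V_def using smooth_on_dilation[OF vector_field_smooth[OF Y], of "1 / c"] c by simp
  have V: "openin (mtop half_line) V" by (rule smooth_on_open[OF sd])
  have \<theta>V: "\<theta> t q \<in> V" if "q \<in> U" for q
    using that \<theta> dilation_inverse[of q c] Up c coord_pos[of q] by (auto simp: V_def dilation_def)
  have inj: "inj_on (\<theta> t) U"
    using \<theta> dilation_inverse c Up by (intro inj_on_inverseI[of _ "dilation (1 / c)"]) auto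
  have Y': "Y' q = tan_vec q (c * ?y (dilation (1 / c) q))" if q: "q \<in> V" for q
  proof -
    define r where "r = dilation (1 / c) q"
    have r: "r \<in> U" using q by (simp add: V_def r_def)
    moreover have "q \<in> points half_line" using q by (simp add: V_def)
    then have "\<theta> t r = q" using \<theta>[OF r] c by (simp add: r_def dilation_def line_coord)
    ultimately have "Y' q = pushforward half_line (\<theta> t) r (Y r)"
      using inv_into_f_f[OF inj r] by (simp add: Y'_def)
    also have "\<dots> = pushforward half_line (\<theta> t) r (tan_vec r (?y r))"
      using vector_field_eq[OF Y r] by simp
    also have "\<dots> = tan_vec q (c * ?y r)" using push[OF r] \<open>\<theta> t r = q\<close> by simp
    finally show ?thesis by (simp add: r_def)
  qed
  have sy: "smooth_on half_line V (\<lambda>q. c * ?y (dilation (1 / c) q))"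
    by (intro smooth_on_mult smooth_on_const V sd)
  have Y'f: "vector_field half_line V Y'" by (rule vector_fieldI[OF sy Y'])
  have dy: "ddx (\<lambda>q. Y' q coord) (\<theta> t p) = ddx ?y p"
  proof -
    have "ddx (\<lambda>q. Y' q coord) (\<theta> t p) = ddx (\<lambda>q. c * ?y (dilation (1 / c) q)) (\<theta> t p)"
      using Y' tan_vec_coord vector_field_in_points[OF Y'f] by (intro ddx_cong[OF V \<theta>V[OF p]]) simp
    also have "\<dots> = c * ddx (\<lambda>q. ?y (dilation (1 / c) q)) (\<theta> t p)"
      using ddx_mult[OF smooth_on_const[OF V] sd \<theta>V[OF p]] by (simp add: ddx_const)
    also have "\<dots> = c * (1 / c * ddx ?y (dilation (1 / c) (\<theta> t p)))"
      using \<theta>V[OF p] by (subst ddx_dilation[OF vector_field_smooth[OF Y]]) (auto simp: V_def)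
    also have "\<dots> = ddx ?y p"
      using c \<theta>[OF p] dilation_inverse[of p c] p Up by auto
    finally show ?thesis .
  qed
  have veq: "v = tan_vec p (v coord)"
    using tangent_space_half_line[OF v] p Up by blast
  have "pushforward half_line (\<theta> t) p v = tan_vec (\<theta> t p) (c * v coord)"
    using push[OF p, of "v coord"] veq by simp
  moreover have "tan_vec (\<theta> t p) (c * v coord) coord = c * v coord"
    using tan_vec_coord[OF vector_field_in_points[OF Y'f \<theta>V[OF p]]] by simp
  ultimately have "line_conn (\<theta> t p) (pushforward half_line (\<theta> t) p v) Y' =
      tan_vec (\<theta> t p) (c * v coord * ddx ?y p)"
    using line_conn_half_line[OF Y'f \<theta>V[OF p] tan_vec_in_tangent_space, of "c * v coord"] dy by simp
  moreover have "pushforward half_line (\<theta> t) p (line_conn p v Y) = tan_vec (\<theta> t p) (c * (v coord * ddx ?y p))"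
    using line_conn_half_line[OF Y p v] push[OF p] by simp
  ultimately show "pushforward half_line (\<theta> t) p (line_conn p v Y) =
     line_conn (\<theta> t p) (pushforward half_line (\<theta> t) p v)
       (\<lambda>q. let r = inv_into U (\<theta> t) q in pushforward half_line (\<theta> t) r (Y r))"
    by (simp add: Y'_def mult.assoc)
qed

section \<open>The homogeneous Hessian metric\<close>

definition power_metric :: "real \<Rightarrow> (nat \<Rightarrow> real) metric" where
  "power_metric a p u v = coord p powr a * u coord * v coord"

lemma smooth_power_metric:
  assumes "vector_field half_line U X" "vector_field half_line U Y"
  shows "smooth_on half_line U (\<lambda>p. power_metric a p (X p) (Y p))"
  unfolding power_metric_def
  by (intro smooth_on_mult smooth_on_powr vector_field_smooth assms vector_field_open[OF assms(1)])

lemma riemannian_power_metric: "riemannian_metric half_line (power_metric a)"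
  unfolding riemannian_metric_def
proof (intro conjI ballI allI impI)
  fix p v assume p: "p \<in> points half_line" and v: "v \<in> tangent_space half_line p" "v \<noteq> (\<lambda>f. 0)"
  have "v coord \<noteq> 0"
  proof
    assume "v coord = 0"
    with tangent_space_half_line[OF v(1) p] have "v = tan_vec p 0" by simp
    also have "\<dots> = (\<lambda>f. 0)" by (rule ext) (simp add: tan_vec_def)
    finally show False using v(2) by simp
  qed
  then have "0 < v coord * v coord" by (simp add: zero_less_mult_iff) linarith
  then show "0 < power_metric a p v v"
    using coord_pos[OF p] by (simp add: power_metric_def mult.assoc)
qed (auto intro: smooth_power_metric, auto simp: power_metric_def algebra_simps)

lemma hessian_power:
  assumes X: "vector_field half_line V X" and Y: "vector_field half_line V Y" and q: "q \<in> V"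
  shows "hessian line_conn (\<lambda>x. k * coord x powr b) X Y q = k * b * (b - 1) * power_metric (b - 2) q (X q) (Y q)"
proof -
  let ?\<phi> = "\<lambda>x. k * coord x powr b"
  note V = vector_field_open[OF X]
  have d: "ddx (\<lambda>x. m * coord x powr e) r = m * e * coord r powr (e - 1)" if "r \<in> V" for m e r
    using ddx_mult[OF smooth_on_const[OF V] smooth_on_powr[OF V] that]
      ddx_powr[OF vector_field_in_points[OF X that]] by (simp add: ddx_const)
  have "ddx (ddx ?\<phi>) q = ddx (\<lambda>x. (k * b) * coord x powr (b - 1)) q"
    by (intro ddx_cong[OF V q] d)
  then have dd: "ddx (ddx ?\<phi>) q = k * b * (b - 1) * coord q powr (b - 2)"
    using d[OF q] by simp
  have \<phi>: "smooth_on half_line V ?\<phi>" by (intro smooth_on_mult smooth_on_const smooth_on_powr V)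
  then have "smooth_on half_line V (\<lambda>r. Y r ?\<phi>)"
    by (rule vector_field_apply_smooth[OF Y])
  then have "hessian line_conn ?\<phi> X Y q = X q coord * Y q coord * ddx (ddx ?\<phi>) q"
    unfolding hessian_def
    using vector_field_apply[OF X _ q q] ddx_vector_field[OF Y \<phi> q] line_conn_fields[OF X Y q]
      tan_vec_apply[OF \<phi> q] by (simp add: algebra_simps)
  then show ?thesis by (simp add: dd power_metric_def)
qed

text \<open>The potential is a multiple of \<open>x powr (a + 2)\<close>. The two excluded exponents are those for which
  the second derivative of this power vanishes, instead of being a nonzero multiple of \<open>x powr a\<close>.\<close>

lemma hessian_manifold_half_line:
  assumes "a \<noteq> - 1" "a \<noteq> - 2"
  shows "hessian_manifold half_line line_conn (power_metric a)"
  unfolding hessian_manifold_def flat_affine_manifold_def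
proof (intro conjI ballI smooth_manifold_half_line connection_line_conn flat_line_conn
    torsion_free_line_conn riemannian_power_metric)
  fix p assume p: "p \<in> points half_line"
  define k where "k = 1 / ((a + 2) * (a + 1))"
  have "k * (a + 2) * (a + 2 - 1) = 1"
    using assms by (simp add: k_def add_eq_0_iff2)
  then have "power_metric a q (X q) (Y q) = hessian line_conn (\<lambda>x. k * coord x powr (a + 2)) X Y q"
    if "vector_field half_line V X" "vector_field half_line V Y" "q \<in> V" for V X Y q
    unfolding hessian_power[OF that] \<open>k * (a + 2) * (a + 2 - 1) = 1\<close> by simp
  moreover have "smooth_on half_line (points half_line) (\<lambda>x. k * coord x powr (a + 2))"
    by (intro smooth_on_mult smooth_on_const smooth_on_powr openin_points)
  ultimately show "\<exists>U \<phi>. p \<in> U \<and> smooth_on half_line U \<phi> \<and>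
     (\<forall>V X Y. V \<subseteq> U \<and> vector_field half_line V X \<and> vector_field half_line V Y \<longrightarrow>
        (\<forall>q\<in>V. power_metric a q (X q) (Y q) = hessian line_conn \<phi> X Y q))"
    using p by blast
qed

text \<open>The field \<open>l x d/dx\<close> multiplies \<open>x powr a\<close> by \<open>l a\<close>, and each factor of \<open>dx\<^sup>2\<close> contributes a
  further \<open>l\<close>.\<close>

lemma lie_deriv_power_metric:
  assumes X: "vector_field half_line U X" and Y: "vector_field half_line U Y" and p: "p \<in> U"
  shows "lie_deriv_metric half_line (\<lambda>p f. l * euler_field p f) (power_metric a) X Y p =
    l * (a + 2) * power_metric a p (X p) (Y p)"
proof -
  let ?\<xi> = "\<lambda>p f. l * euler_field p f"
  note U = vector_field_open[OF X] and pp = vector_field_in_points[OF X p]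
  have \<xi>: "vector_field half_line U ?\<xi>"
    using vector_field_subset[OF vector_field_scaled_euler U] U by (simp add: openin_half_line)
  have \<xi>c: "?\<xi> q coord = l * coord q" if "q \<in> U" for q
    using vector_field_in_points[OF X that] by (simp add: euler_field_def tan_vec_coord)
  have "ddx (\<lambda>q. ?\<xi> q coord) p = ddx (\<lambda>q. l * coord q) p"
    by (intro ddx_cong[OF U p] \<xi>c)
  then have d\<xi>: "ddx (\<lambda>q. ?\<xi> q coord) p = l"
    using ddx_mult[OF smooth_on_const[OF U] smooth_on_coord[OF U] p] by (simp add: ddx_const ddx_coord)
  have br: "bracket half_line ?\<xi> Z p coord = l * coord p * ddx (\<lambda>q. Z q coord) p - Z p coord * l"
    if Z: "vector_field half_line U Z" for Z
    using bracket_half_line[OF \<xi> Z p] tan_vec_coord[OF pp] \<xi>c[OF p] d\<xi> by simp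
  have sP: "smooth_on half_line U (\<lambda>q. coord q powr a)" by (rule smooth_on_powr[OF U])
  note sX = vector_field_smooth[OF X] and sY = vector_field_smooth[OF Y]
  have "?\<xi> p (\<lambda>q. power_metric a q (X q) (Y q)) =
      l * coord p * ddx (\<lambda>q. power_metric a q (X q) (Y q)) p"
    using vector_field_apply[OF \<xi> smooth_power_metric[OF X Y] p p] \<xi>c[OF p] by simp
  also have "\<dots> = l * coord p * ((a * coord p powr (a - 1) * X p coord + coord p powr a * ddx (\<lambda>q. X q coord) p) * Y p coord
      + coord p powr a * X p coord * ddx (\<lambda>q. Y q coord) p)"
    unfolding power_metric_def
    using ddx_mult[OF smooth_on_mult[OF sP sX] sY p] ddx_mult[OF sP sX p] ddx_powr[OF pp] by simp
  finally have derivative: "?\<xi> p (\<lambda>q. power_metric a q (X q) (Y q)) = \<dots>" .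
  have "coord p powr a = coord p * coord p powr (a - 1)"
    using coord_pos[OF pp] by (simp add: powr_diff)
  then show ?thesis
    unfolding lie_deriv_metric_def derivative
    by (simp add: power_metric_def br[OF X] br[OF Y] algebra_simps)
qed

theorem corollary3p22:
  fixes l :: real
  assumes "l \<noteq> 0" and "l \<noteq> 2"
  shows "\<exists>(C :: (nat \<Rightarrow> real) manifold) D g \<xi> \<rho>.
           radiant_hessian_manifold C D g \<xi> \<and>
           radiant_vector_field C D \<rho> \<and>
           (\<forall>p\<in>points C. \<xi> p = (\<lambda>f. l * \<rho> p f))"
proof -
  let ?\<xi> = "\<lambda>p f. l * euler_field p f"
  \<comment> \<open>The exponent solves \<open>l * (a + 2) = 2\<close>. It is never \<open>- 2\<close>, and it is \<open>- 1\<close> exactly for \<open>l = 2\<close>.\<close>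
  define a where "a = 2 / l - 2"
  have a: "a \<noteq> - 1" "a \<noteq> - 2" "l * (a + 2) = 2"
    using assms by (auto simp: a_def field_simps)
  have "selfsimilar_hessian_manifold half_line line_conn (power_metric a) ?\<xi>"
    unfolding selfsimilar_hessian_manifold_def
    using hessian_manifold_half_line[OF a(1,2)] vector_field_scaled_euler flow_preserves_euler
    by (auto simp: lie_deriv_power_metric a(3))
  moreover note radiant_euler_field
  ultimately have "radiant_hessian_manifold half_line line_conn (power_metric a) ?\<xi>"
    unfolding radiant_hessian_manifold_def using assms by blast
  then show ?thesis using radiant_euler_field by blast
qed

end
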